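(* Let $V$ be a vector space of dimension $2g$ over $\mathbb{F}_2$ ($g\ge 1$) with a non-degenerate alternating bilinear form $\langle\,,\rangle$, let $\mathscr{F}=\{v_1,\dots,v_{2g+1}\}$ be a fundamental set of $V$, let $q$ be any quadratic form on $V$, and let $\mu\in\{0,1\}$. Put $w:=\sum_{v\in\mathscr{F},\ q(v)=\mu}v$ and $q_i:=q+w+v_i$ for $i=1,\dots,2g+1$. Then $\mathcal{A}:=\{q_1,\dots,q_{2g+1}\}$ is an Aronhold basis.
   Context: A quadratic form on $(V,\langle\,,\rangle)$ is a map $q:V\to\mathbb{F}_2$ with $q(u+v)=q(u)+q(v)+\langle u,v\rangle$ for all $u,v\in V$; $\mathrm{QV}$ denotes the set of all of them. $V$ acts freely and transitively on $\mathrm{QV}$ by $(q+v)(u)=q(u)+\langle v,u\rangle$; for $q,q'\in\mathrm{QV}$, $q+q'$ denotes the unique $v\in V$ with $\langle v,u\rangle=q(u)+q'(u)$ for all $u$. With these operations the disjoint union $V\sqcup\mathrm{QV}$ is an $\mathbb{F}_2$-vector space of dimension $2g+1$. A symplectic basis of $V$ is a basis $e_1,\dots,e_g,f_1,\dots,f_g$ with $\langle e_i,e_j\rangle=\langle f_i,f_j\rangle=0$ and $\langle e_i,f_j\rangle=\delta_{ij}$. The Arf invariant of $q\in\mathrm{QV}$ is $a(q)=\sum_{i=1}^g q(e_i)q(f_i)\in\mathbb{F}_2$, which does not depend on the choice of symplectic basis. Fundamental set: a set $\{v_1,\dots,v_{2g+1}\}\subset V$ such that $\sum_{i=1}^{2g+1}v_i=0$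 and $\langle v_i,v_j\rangle=1$ for all $1\le i\ne j\le 2g+1$. Aronhold basis: a set $S=\{q_1,\dots,q_{2g+1}\}\subset\mathrm{QV}$ of $2g+1$ linearly independent vectors of $V\sqcup\mathrm{QV}$ such that the Arf invariant $a(q)$ of any $q\in\mathrm{QV}$ depends only on $\#q$ modulo $4$, where $\#q$ (the length of $q$) is the number of nonzero coefficients in the unique expression $q=\sum_i\alpha_iq_i$, $\alpha_i\in\{0,1\}$ (this number is odd for $q\in\mathrm{QV}$). *)

theory Defs
  imports
    "HOL-Library.Z2"
    "HOL-Library.FuncSet"
    "HOL-Number_Theory.Cong"
    "Jordan_Normal_Form.VS_Connect"
begin

text \<open>The field with two elements is the type \<open>bit\<close>, used as a ring record through
  \<open>class_ring\<close>.\<close>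

locale symplectic_space = vectorspace "class_ring :: bit ring" V
  for V :: "(bit, 'v, 'm) module_scheme" (structure) +
  fixes B :: "'v \<Rightarrow> 'v \<Rightarrow> bit" and g :: nat
  assumes fin_dim: "vectorspace.fin_dim (class_ring :: bit ring) V"
    and dim: "vectorspace.dim (class_ring :: bit ring) V = 2 * g"
    and add_left: "\<lbrakk>u \<in> carrier V; u' \<in> carrier V; v \<in> carrier V\<rbrakk>
           \<Longrightarrow> B (u \<oplus> u') v = B u v + B u' v"
    and add_right: "\<lbrakk>u \<in> carrier V; v \<in> carrier V; v' \<in> carrier V\<rbrakk>
           \<Longrightarrow> B u (v \<oplus> v') = B u v + B u v'"
    and smult_left: "\<lbrakk>u \<in> carrier V; v \<in> carrier V\<rbrakk> \<Longrightarrow> B (a \<odot>\<^bsub>V\<^esub> u) v = a * B u v"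
    and smult_right: "\<lbrakk>u \<in> carrier V; v \<in> carrier V\<rbrakk> \<Longrightarrow> B u (a \<odot>\<^bsub>V\<^esub> v) = a * B u v"
    and alternating: "u \<in> carrier V \<Longrightarrow> B u u = 0"
    and nondegenerate: "\<lbrakk>u \<in> carrier V; \<And>v. v \<in> carrier V \<Longrightarrow> B u v = 0\<rbrakk> \<Longrightarrow> u = \<zero>"

text \<open>Quadratic forms are functions on \<open>carrier V\<close>, hence taken extensional, so that equality
  in \<open>QV\<close> is equality on \<open>carrier V\<close>.\<close>

definition QV :: "(bit, 'v, 'm) module_scheme \<Rightarrow> ('v \<Rightarrow> 'v \<Rightarrow> bit) \<Rightarrow> ('v \<Rightarrow> bit) set" where
  "QV V B = {q \<in> carrier V \<rightarrow>\<^sub>E UNIV.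
     \<forall>u\<in>carrier V. \<forall>v\<in>carrier V. q (u \<oplus>\<^bsub>V\<^esub> v) = q u + q v + B u v}"

definition qf_add ::
  "(bit, 'v, 'm) module_scheme \<Rightarrow> ('v \<Rightarrow> 'v \<Rightarrow> bit) \<Rightarrow> ('v \<Rightarrow> bit) \<Rightarrow> 'v \<Rightarrow> ('v \<Rightarrow> bit)" where
  "qf_add V B q v = (\<lambda>u\<in>carrier V. q u + B v u)"

definition qf_diff ::
  "(bit, 'v, 'm) module_scheme \<Rightarrow> ('v \<Rightarrow> 'v \<Rightarrow> bit) \<Rightarrow> ('v \<Rightarrow> bit) \<Rightarrow> ('v \<Rightarrow> bit) \<Rightarrow> 'v" where
  "qf_diff V B q q' = (THE v. v \<in> carrier V \<and> (\<forall>u\<in>carrier V. B v u = q u + q' u))"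

fun VQV_add ::
  "(bit, 'v, 'm) module_scheme \<Rightarrow> ('v \<Rightarrow> 'v \<Rightarrow> bit) \<Rightarrow>
     'v + ('v \<Rightarrow> bit) \<Rightarrow> 'v + ('v \<Rightarrow> bit) \<Rightarrow> 'v + ('v \<Rightarrow> bit)" where
  "VQV_add V B (Inl u) (Inl v) = Inl (u \<oplus>\<^bsub>V\<^esub> v)"
| "VQV_add V B (Inr q) (Inl v) = Inr (qf_add V B q v)"
| "VQV_add V B (Inl v) (Inr q) = Inr (qf_add V B q v)"
| "VQV_add V B (Inr q) (Inr q') = Inl (qf_diff V B q q')"

text \<open>The vector space on the disjoint union of \<open>V\<close> and \<open>QV\<close>. The fields \<open>mult\<close> and \<open>one\<close>
  play no role for a module record.\<close>

definition VQV ::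
  "(bit, 'v, 'm) module_scheme \<Rightarrow> ('v \<Rightarrow> 'v \<Rightarrow> bit) \<Rightarrow> (bit, 'v + ('v \<Rightarrow> bit)) module" where
  "VQV V B = \<lparr>carrier = carrier V <+> QV V B, mult = undefined, one = undefined,
     zero = Inl \<zero>\<^bsub>V\<^esub>, add = VQV_add V B,
     smult = (\<lambda>a x. if a = 0 then Inl \<zero>\<^bsub>V\<^esub> else x)\<rparr>"

definition symplectic_basis ::
  "(bit, 'v, 'm) module_scheme \<Rightarrow> ('v \<Rightarrow> 'v \<Rightarrow> bit) \<Rightarrow> nat \<Rightarrow> (nat \<Rightarrow> 'v) \<Rightarrow> (nat \<Rightarrow> 'v) \<Rightarrow> bool" where
  "symplectic_basis V B g e f \<longleftrightarrow>
     vectorspace.basis (class_ring :: bit ring) V (e ` {1..g} \<union> f ` {1..g}) \<and>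
     (\<forall>i\<in>{1..g}. \<forall>j\<in>{1..g}. B (e i) (e j) = 0 \<and> B (f i) (f j) = 0 \<and>
        B (e i) (f j) = (if i = j then 1 else 0))"

text \<open>The sum does not depend on the symplectic basis, so \<open>THE\<close> picks out the unique value
  arising from some symplectic basis.\<close>

definition arf ::
  "(bit, 'v, 'm) module_scheme \<Rightarrow> ('v \<Rightarrow> 'v \<Rightarrow> bit) \<Rightarrow> nat \<Rightarrow> ('v \<Rightarrow> bit) \<Rightarrow> bit" where
  "arf V B g q =
     (THE a. \<exists>e f. symplectic_basis V B g e f \<and> a = (\<Sum>i=1..g. q (e i) * q (f i)))"

text \<open>Pairwise pairing 1 forces the vectors to be distinct when \<open>B\<close> is alternating, so a
  fundamental set has exactly \<open>2 * g + 1\<close> elements.\<close>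

definition fundamental_set ::
  "(bit, 'v, 'm) module_scheme \<Rightarrow> ('v \<Rightarrow> 'v \<Rightarrow> bit) \<Rightarrow> nat \<Rightarrow> 'v set \<Rightarrow> bool" where
  "fundamental_set V B g F \<longleftrightarrow>
     F \<subseteq> carrier V \<and> card F = 2 * g + 1 \<and> (\<Oplus>\<^bsub>V\<^esub>v\<in>F. v) = \<zero>\<^bsub>V\<^esub> \<and>
     (\<forall>u\<in>F. \<forall>v\<in>F. u \<noteq> v \<longrightarrow> B u v = 1)"

definition coeffs_wrt ::
  "(bit, 'v, 'm) module_scheme \<Rightarrow> ('v \<Rightarrow> 'v \<Rightarrow> bit) \<Rightarrow> ('v \<Rightarrow> bit) set \<Rightarrow> ('v \<Rightarrow> bit) \<Rightarrow>
     'v + ('v \<Rightarrow> bit) \<Rightarrow> bit" where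
  "coeffs_wrt V B S q =
     (THE \<alpha>. \<alpha> \<in> Inr ` S \<rightarrow>\<^sub>E UNIV \<and>
        module.lincomb (VQV V B) \<alpha> (Inr ` S) = Inr q)"

definition qf_length ::
  "(bit, 'v, 'm) module_scheme \<Rightarrow> ('v \<Rightarrow> 'v \<Rightarrow> bit) \<Rightarrow> ('v \<Rightarrow> bit) set \<Rightarrow> ('v \<Rightarrow> bit) \<Rightarrow> nat" where
  "qf_length V B S q = card {s \<in> S. coeffs_wrt V B S q (Inr s) \<noteq> 0}"

definition aronhold_basis ::
  "(bit, 'v, 'm) module_scheme \<Rightarrow> ('v \<Rightarrow> 'v \<Rightarrow> bit) \<Rightarrow> nat \<Rightarrow> ('v \<Rightarrow> bit) set \<Rightarrow> bool" where
  "aronhold_basis V B g S \<longleftrightarrow>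
     S \<subseteq> QV V B \<and> card S = 2 * g + 1 \<and>
     \<not> module.lin_dep (class_ring :: bit ring) (VQV V B) (Inr ` S) \<and>
     (\<forall>q\<in>QV V B. \<forall>q'\<in>QV V B.
        [qf_length V B S q = qf_length V B S q'] (mod 4) \<longrightarrow> arf V B g q = arf V B g q')"

end

theory Submission
  imports Defs
begin

text \<open>
  Put \<open>p = q + w\<close>. Let \<open>T\<close> be the set of the \<open>v\<close> in \<open>F\<close> with \<open>q v = \<mu>\<close>, so that \<open>w\<close> is the sum of
  \<open>T\<close>. Pairing \<open>w\<close> with \<open>v \<in> F\<close> counts the members of \<open>T\<close> other than \<open>v\<close>, which corrects exactly for
  the two possible values of \<open>q v\<close>: the form \<open>p\<close> is constant on \<open>F\<close>. Since \<open>F\<close> sums to zero, the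
  quadratic relation leaves only one possible constant, namely \<open>g\<close> modulo 2
  (\<open>level_set_translate_on_F\<close>, \<open>constant_on_F\<close>). The rest of the argument concerns the translates
  \<open>p + v\<close> of such a form \<open>p\<close>.

  Independence and coordinates. The disjoint union of \<open>V\<close> and \<open>QV\<close> embeds into pairs consisting of a
  parity bit and a function \<open>V \<rightarrow> bit\<close>, by \<open>v \<mapsto> (0, B v)\<close> and \<open>q \<mapsto> (1, q)\<close>, and this turns its addition
  into pointwise addition. Hence a linear combination of the \<open>p + v\<close> is controlled by two sums of
  bits: the parity gives the sum of the coefficients \<open>\<alpha>\<close>, and evaluation at \<open>v \<in> F\<close>, where \<open>B u v\<close> is
  1 for all \<open>u \<noteq> v\<close>, gives that sum plus \<open>\<alpha> v\<close>. So the coefficients can be read off. The combination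
  is zero only if all of them vanish, and it is a quadratic form \<open>q\<close> exactly when \<open>\<alpha> v = p v + q v + 1\<close>
  (\<open>lincomb_translates_eq_iff\<close>); existence uses that \<open>F\<close> spans \<open>V\<close>. Consequently the length of \<open>q\<close>
  is the number of members of \<open>F\<close> on which \<open>p\<close> and \<open>q\<close> agree, and \<open>q = p + s\<close> with \<open>s\<close> the sum of
  these members.

  Arf invariants. Expanding \<open>v\<close> in a symplectic basis shows \<open>a(p + v) = a(p) + p(v)\<close>, where \<open>a\<close> is
  the Arf sum over that basis (\<open>arf_sum_qf_add\<close>). So the Arf invariant of \<open>q = p + s\<close> depends only on
  \<open>p s\<close>. For a sum \<open>s\<close> of \<open>k\<close> members of \<open>F\<close> the value \<open>p s\<close> is \<open>k g + (k choose 2)\<close>, because \<open>p\<close> is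
  \<open>g\<close> on \<open>F\<close> and each pair contributes 1; modulo 2 this depends only on \<open>k\<close> modulo 4.
\<close>

section \<open>Arithmetic modulo two\<close>

text \<open>Rewriting the field operations to bitwise ones would hide sums and products from the ring
  lemmas.\<close>

declare add_bit_eq_xor [simp del] mult_bit_eq_and [simp del]

lemma bit_add_self [simp]: "x + x = (0::bit)"
  by (cases x) simp_all

lemma bit_add_eq_zero_iff: "x + y = 0 \<longleftrightarrow> x = (y::bit)"
  by (cases x; cases y) simp_all

lemma bit_add_eq_iff: "x + y = z \<longleftrightarrow> x = z + (y::bit)"
  by (cases x; cases y; cases z) simp_all

lemma of_nat_choose_two_bit_cong:
  assumes "[m = n] (mod 4)"
  shows "(of_nat (m choose 2) :: bit) = of_nat (n choose 2)"
proof -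
  have step: "(of_nat ((k + 4) choose 2) :: bit) = of_nat (k choose 2)" for k :: nat
  proof -
    have "(k + 4) choose 2 = (k choose 2) + 2 * (2 * k + 3)"
      by (simp add: numeral_eq_Suc)
    then show ?thesis
      by (simp only: of_nat_add of_nat_mult) simp
  qed
  have steps: "(of_nat ((k + 4 * l) choose 2) :: bit) = of_nat (k choose 2)" for k l :: nat
  proof (induction l)
    case (Suc l)
    have "k + 4 * Suc l = (k + 4 * l) + 4" by simp
    with Suc step[of "k + 4 * l"] show ?case by (simp only:)
  qed simp
  have reduce: "(of_nat (k choose 2) :: bit) = of_nat ((k mod 4) choose 2)" for k :: nat
    using steps[of "k mod 4" "k div 4"] by simp
  show ?thesis
    using assms reduce[of m] reduce[of n] by (simp add: cong_def)
qed

lemma of_nat_bit_cong_mod_4: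
  assumes "[m = n] (mod 4)"
  shows "(of_nat m :: bit) = of_nat n"
proof -
  have "(of_nat k :: bit) = of_nat (k mod 4)" for k :: nat
  proof -
    have "(of_nat k :: bit) = of_nat (k mod 4 + 4 * (k div 4))" by simp
    also have "\<dots> = of_nat (k mod 4)" by (simp only: of_nat_add of_nat_mult) simp
    finally show ?thesis .
  qed
  with assms show ?thesis by (metis cong_def)
qed

text \<open>The matrix with zero diagonal and ones elsewhere is the Gram matrix of a fundamental set; over
  the field with two elements it differs from the all-ones matrix by the identity.\<close>

lemma sum_off_diagonal:
  fixes a :: "'i \<Rightarrow> bit"
  assumes "finite A" "j \<in> A"
  shows "(\<Sum>i\<in>A. a i * (if i = j then 0 else 1)) = sum a A + a j"
proof -
  have "(\<Sum>i\<in>A. a i * (if i = j then 0 else 1)) = sum a (A - {j})"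
    using assms by (intro sum.mono_neutral_cong_right) auto
  then show ?thesis
    using sum.remove[OF assms, of a] by (simp add: ac_simps)
qed

lemma sum_bit_support:
  fixes \<alpha> :: "'i \<Rightarrow> bit"
  assumes "finite A"
  shows "(\<Sum>i\<in>A. \<alpha> i * h i) = sum h {i \<in> A. \<alpha> i = 1}"
  using assms by (intro sum.mono_neutral_cong_right) auto

section \<open>Linear functionals and the pairing\<close>

context symplectic_space
begin

lemma smult_bit: "v \<in> carrier V \<Longrightarrow> a \<odot>\<^bsub>V\<^esub> v = (if a = 0 then \<zero> else v)"
  using lmult_0[of v] smult_one[of v] by (cases a) auto

lemma zero_pairing [simp]: "u \<in> carrier V \<Longrightarrow> B \<zero> u = 0"
  using add_left[of \<zero> \<zero> u] by simp

lemma pairing_zero [simp]: "u \<in> carrier V \<Longrightarrow> B u \<zero> = 0"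
  using add_right[of u \<zero> \<zero>] by simp

lemma pairing_sym:
  assumes "u \<in> carrier V" "v \<in> carrier V"
  shows "B u v = B v u"
proof -
  have "B v u + B u v = B (u \<oplus> v) (u \<oplus> v)"
    using assms by (simp add: add_left add_right alternating[of u] alternating[of v])
  also have "\<dots> = 0" using assms by (intro alternating) auto
  finally have "B v u + B u v = 0" .
  then show ?thesis by (simp only: bit_add_eq_zero_iff)
qed

lemma pairing_inject:
  assumes "u \<in> carrier V" "v \<in> carrier V" "\<And>x. x \<in> carrier V \<Longrightarrow> B u x = B v x"
  shows "u = v"
proof -
  have self: "v \<oplus> v = \<zero>"
    using assms(2) by (intro nondegenerate) (auto simp: add_left)
  have "u \<oplus> v = \<zero>"
    using assms by (intro nondegenerate) (auto simp: add_left)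
  then have "u \<oplus> v \<oplus> v = v" using assms(2) by simp
  then show ?thesis using self assms(1,2) by (simp only: a_assoc r_zero)
qed

text \<open>Over the field with two elements additive functions are the same as linear functionals.\<close>

definition additive :: "('v \<Rightarrow> bit) \<Rightarrow> bool" where
  "additive h \<longleftrightarrow> (\<forall>u\<in>carrier V. \<forall>v\<in>carrier V. h (u \<oplus> v) = h u + h v)"

lemma additive_zero:
  assumes "additive h"
  shows "h \<zero> = 0"
proof -
  have "h (\<zero> \<oplus> \<zero>) = h \<zero> + h \<zero>"
    using assms unfolding additive_def by blast
  then show ?thesis by simp
qed

lemma additive_finsum:
  assumes "additive h" "f \<in> I \<rightarrow> carrier V"
  shows "finite I \<Longrightarrow> h (\<Oplus>i\<in>I. f i) = (\<Sum>i\<in>I. h (f i))"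
  using assms(2)
proof (induction I rule: infinite_finite_induct)
  case (insert i I)
  then have "f i \<in> carrier V" "(\<Oplus>i\<in>I. f i) \<in> carrier V" by auto
  with insert assms(1) show ?case by (simp add: additive_def Pi_iff)
qed (simp_all add: additive_zero[OF assms(1)])

lemma additive_pairing_left: "u \<in> carrier V \<Longrightarrow> additive (\<lambda>v. B v u)"
  by (simp add: additive_def add_left)

lemma additive_pairing_right: "u \<in> carrier V \<Longrightarrow> additive (B u)"
  by (simp add: additive_def add_right)

lemma pairing_finsum_left:
  assumes "finite I" "f \<in> I \<rightarrow> carrier V" "u \<in> carrier V"
  shows "B (\<Oplus>i\<in>I. f i) u = (\<Sum>i\<in>I. B (f i) u)"
  using additive_finsum[OF additive_pairing_left[OF assms(3)] assms(2,1)] .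

lemma additive_eq_on_span:
  assumes "A \<subseteq> carrier V" "span A = carrier V" "additive h" "additive h'"
    and agree: "\<And>a. a \<in> A \<Longrightarrow> h a = h' a" and "u \<in> carrier V"
  shows "h u = h' u"
proof -
  have "u \<in> span A" using assms(2,6) by simp
  then obtain c C where C: "finite C" "C \<subseteq> A" "u = lincomb c C"
    by (auto simp: span_def)
  have val: "k u = (\<Sum>a\<in>C. c a * k a)" if "additive k" for k
  proof -
    have "k u = (\<Sum>a\<in>C. k (c a \<odot>\<^bsub>V\<^esub> a))"
      unfolding C(3) lincomb_def
      using C(1,2) assms(1) by (intro additive_finsum that) auto
    also have "\<dots> = (\<Sum>a\<in>C. c a * k a)"
      using C(2) assms(1) by (intro sum.cong) (auto simp: smult_bit additive_zero[OF that])
    finally show ?thesis .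
  qed
  show ?thesis
    unfolding val[OF assms(3)] val[OF assms(4)] using agree C(2) by (intro sum.cong) auto
qed

section \<open>Quadratic forms\<close>

lemma QV_add:
  "q \<in> QV V B \<Longrightarrow> u \<in> carrier V \<Longrightarrow> v \<in> carrier V \<Longrightarrow> q (u \<oplus> v) = q u + q v + B u v"
  by (simp add: QV_def)

lemma QV_eqI:
  assumes "q \<in> QV V B" "q' \<in> QV V B" "\<And>u. u \<in> carrier V \<Longrightarrow> q u = q' u"
  shows "q = q'"
  using assms by (auto simp: QV_def intro: PiE_ext)

lemma QV_zero: "q \<in> QV V B \<Longrightarrow> q \<zero> = 0"
  using QV_add[of q \<zero> \<zero>] by simp

lemma qf_add_apply [simp]: "u \<in> carrier V \<Longrightarrow> qf_add V B q v u = q u + B v u"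
  by (simp add: qf_add_def)

lemma qf_add_closed [intro]:
  assumes "q \<in> QV V B" "v \<in> carrier V"
  shows "qf_add V B q v \<in> QV V B"
  using assms by (auto simp: QV_def qf_add_def add_right ac_simps)

text \<open>The pairing terms of the two forms cancel.\<close>

lemma additive_QV_diff:
  assumes "q \<in> QV V B" "q' \<in> QV V B"
  shows "additive (\<lambda>u. q u + q' u)"
  unfolding additive_def
proof (intro ballI)
  fix u v assume "u \<in> carrier V" "v \<in> carrier V"
  then show "q (u \<oplus> v) + q' (u \<oplus> v) = q u + q' u + (q v + q' v)"
    using assms by (cases "B u v") (simp_all add: QV_add ac_simps)
qed

lemma QV_finsum_orthogonal:
  assumes q: "q \<in> QV V B" and "finite I" "f \<in> I \<rightarrow> carrier V"
    and "\<And>i j. i \<in> I \<Longrightarrow> j \<in> I \<Longrightarrow> i \<noteq> j \<Longrightarrow> B (f i) (f j) = 0"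
  shows "q (\<Oplus>i\<in>I. f i) = (\<Sum>i\<in>I. q (f i))"
  using assms(2-)
proof (induction I rule: finite_induct)
  case (insert i I)
  then have cl: "f i \<in> carrier V" "f \<in> I \<rightarrow> carrier V" "(\<Oplus>i\<in>I. f i) \<in> carrier V" by auto
  have "B (\<Oplus>j\<in>I. f j) (f i) = (\<Sum>j\<in>I. B (f j) (f i))"
    using insert.hyps(1) cl by (intro pairing_finsum_left) auto
  also have "\<dots> = 0"
    using insert.hyps insert.prems(2) by (intro sum.neutral) auto
  finally have "B (f i) (\<Oplus>j\<in>I. f j) = 0"
    using cl by (simp add: pairing_sym)
  with insert cl show ?case
    by (simp add: QV_add[OF q])
qed (simp add: QV_zero[OF q])

lemma QV_finsum_pairing_one:
  assumes q: "q \<in> QV V B" and "finite T" "T \<subseteq> carrier V"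
    and "\<And>u v. u \<in> T \<Longrightarrow> v \<in> T \<Longrightarrow> u \<noteq> v \<Longrightarrow> B u v = 1"
  shows "q (\<Oplus>v\<in>T. v) = (\<Sum>v\<in>T. q v) + of_nat (card T choose 2)"
  using assms(2-)
proof (induction T rule: finite_induct)
  case (insert t T)
  then have cl: "t \<in> carrier V" "T \<subseteq> carrier V" "(\<Oplus>v\<in>T. v) \<in> carrier V"
    by (auto intro!: finsum_closed)
  have "B (\<Oplus>v\<in>T. v) t = (\<Sum>v\<in>T. B v t)"
    using insert.hyps(1) cl by (intro pairing_finsum_left) auto
  also have "\<dots> = (\<Sum>v\<in>T. 1)"
    using insert.hyps insert.prems(2) by (intro sum.cong) auto
  finally have "B t (\<Oplus>v\<in>T. v) = of_nat (card T)"
    using cl by (simp add: pairing_sym)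
  moreover have "(\<Oplus>v\<in>insert t T. v) = t \<oplus> (\<Oplus>v\<in>T. v)"
    using insert.hyps cl by (intro finsum_insert) auto
  ultimately show ?case
    using insert cl by (simp add: QV_add[OF q] numeral_2_eq_2 ac_simps)
qed (simp add: QV_zero[OF q] numeral_2_eq_2)

section \<open>Translation and the Arf invariant\<close>

lemma symplectic_basis_span:
  assumes "symplectic_basis V B g e f"
  shows "e ` {1..g} \<union> f ` {1..g} \<subseteq> carrier V" "span (e ` {1..g} \<union> f ` {1..g}) = carrier V"
  using assms by (auto simp: symplectic_basis_def basis_def)

lemma symplectic_basis_pairing:
  assumes "symplectic_basis V B g e f" "i \<in> {1..g}" "j \<in> {1..g}"
  shows "B (e i) (e j) = 0" "B (f i) (f j) = 0" "B (e i) (f j) = (if i = j then 1 else 0)"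
    "B (f i) (e j) = (if i = j then 1 else 0)"
proof -
  show *: "B (e i) (e j) = 0" "B (f i) (f j) = 0" "B (e i) (f j) = (if i = j then 1 else 0)"
    using assms by (auto simp: symplectic_basis_def)
  have "B (f i) (e j) = B (e j) (f i)"
    using symplectic_basis_span(1)[OF assms(1)] assms(2,3) by (intro pairing_sym) auto
  then show "B (f i) (e j) = (if i = j then 1 else 0)"
    using assms by (auto simp: symplectic_basis_def)
qed

text \<open>Both sides have the same pairing with every basis vector, hence with every vector, and the
  form is non-degenerate.\<close>

lemma symplectic_expansion:
  assumes E: "symplectic_basis V B g e f" and v: "v \<in> carrier V"
  shows "v = (\<Oplus>i\<in>{1..g}. B v (f i) \<odot>\<^bsub>V\<^esub> e i \<oplus> B v (e i) \<odot>\<^bsub>V\<^esub> f i)" (is "v = ?r")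
proof (rule pairing_inject)
  have cl: "e i \<in> carrier V" "f i \<in> carrier V" if "i \<in> {1..g}" for i
    using symplectic_basis_span(1)[OF E] that by auto
  note orth = symplectic_basis_pairing[OF E]
  show r: "?r \<in> carrier V" using cl by (intro finsum_closed) auto
  have pair: "B ?r u = (\<Sum>i=1..g. B v (f i) * B (e i) u + B v (e i) * B (f i) u)"
    if "u \<in> carrier V" for u
    using cl that
    by (subst pairing_finsum_left) (auto simp: add_left smult_left intro!: sum.cong)
  have on_basis: "B v b = B ?r b" if "b \<in> e ` {1..g} \<union> f ` {1..g}" for b
  proof -
    from that consider j where "j \<in> {1..g}" "b = e j" | j where "j \<in> {1..g}" "b = f j" by auto
    then show ?thesis
    proof cases
      case (1 j)
      have "B ?r b = (\<Sum>i=1..g. if i = j then B v (e j) else 0)"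
        unfolding 1(2) pair[OF cl(1)[OF 1(1)]]
        by (intro sum.cong) (auto simp: orth[OF _ 1(1)])
      then show ?thesis using 1 by simp
    next
      case (2 j)
      have "B ?r b = (\<Sum>i=1..g. if i = j then B v (f j) else 0)"
        unfolding 2(2) pair[OF cl(2)[OF 2(1)]]
        by (intro sum.cong) (auto simp: orth[OF _ 2(1)])
      then show ?thesis using 2 by simp
    qed
  qed
  show "B v u = B ?r u" if "u \<in> carrier V" for u
    by (rule additive_eq_on_span[OF symplectic_basis_span[OF E] additive_pairing_right[OF v]
          additive_pairing_right[OF r] on_basis that])
qed (fact v)

text \<open>Multiplying out the left side, the terms other than \<open>q (e i) * q (f i)\<close> are
  \<open>B v (f i) * q (e i) + B v (e i) * q (f i) + B v (e i) * B v (f i)\<close>. This is the value of \<open>q\<close> at the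
  component of \<open>v\<close> in the plane spanned by \<open>e i\<close> and \<open>f i\<close>. These planes are orthogonal to each
  other, so the values add up to \<open>q v\<close>.\<close>

lemma arf_sum_qf_add:
  assumes E: "symplectic_basis V B g e f" and q: "q \<in> QV V B" and v: "v \<in> carrier V"
  shows "(\<Sum>i=1..g. qf_add V B q v (e i) * qf_add V B q v (f i))
    = (\<Sum>i=1..g. q (e i) * q (f i)) + q v"
proof -
  let ?u = "\<lambda>i. B v (f i) \<odot>\<^bsub>V\<^esub> e i \<oplus> B v (e i) \<odot>\<^bsub>V\<^esub> f i"
  have cl: "e i \<in> carrier V" "f i \<in> carrier V" if "i \<in> {1..g}" for i
    using symplectic_basis_span(1)[OF E] that by auto
  note orth = symplectic_basis_pairing[OF E]
  have "q (\<Oplus>i\<in>{1..g}. ?u i) = (\<Sum>i=1..g. q (?u i))"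
    using cl by (intro QV_finsum_orthogonal q)
      (auto simp: add_left add_right smult_left smult_right orth)
  then have "q v = (\<Sum>i=1..g. q (?u i))"
    using symplectic_expansion[OF E v] by simp
  moreover have "qf_add V B q v (e i) * qf_add V B q v (f i) = q (e i) * q (f i) + q (?u i)"
    if "i \<in> {1..g}" for i
    using cl[OF that] orth[OF that that] that
    by (cases "B v (e i)"; cases "B v (f i)"; cases "q (e i)"; cases "q (f i)")
      (simp_all add: smult_bit QV_add[OF q] QV_zero[OF q])
  ultimately show ?thesis
    by (simp add: sum.distrib)
qed

text \<open>For each symplectic basis separately, the Arf sums of the two translates agree. So the two
  descriptions of the Arf invariant by \<open>THE\<close> have the same predicate.\<close>

lemma arf_qf_add_cong:
  assumes "q \<in> QV V B" "v \<in> carrier V" "v' \<in> carrier V" "q v = q v'"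
  shows "arf V B g (qf_add V B q v) = arf V B g (qf_add V B q v')"
proof -
  have "(\<exists>e f. symplectic_basis V B g e f \<and>
      a = (\<Sum>i=1..g. qf_add V B q v (e i) * qf_add V B q v (f i))) \<longleftrightarrow>
    (\<exists>e f. symplectic_basis V B g e f \<and>
      a = (\<Sum>i=1..g. qf_add V B q v' (e i) * qf_add V B q v' (f i)))" for a
    using arf_sum_qf_add[OF _ assms(1,2)] arf_sum_qf_add[OF _ assms(1,3)] assms(4)
    by (metis (no_types, lifting))
  then show ?thesis unfolding arf_def by simp
qed

end

section \<open>Fundamental sets\<close>

locale fundamental_space = symplectic_space V B g
  for V :: "(bit, 'v, 'm) module_scheme" (structure) and B g +
  fixes F :: "'v set"
  assumes fundamental: "fundamental_set V B g F"
begin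

lemma F_carrier: "F \<subseteq> carrier V"
  and F_card: "card F = 2 * g + 1"
  and F_sum: "(\<Oplus>v\<in>F. v) = \<zero>"
  and F_pairing: "u \<in> F \<Longrightarrow> v \<in> F \<Longrightarrow> B u v = (if u = v then 0 else 1)"
  using fundamental alternating by (auto simp: fundamental_set_def)

lemma F_in [simp, intro]: "v \<in> F \<Longrightarrow> v \<in> carrier V"
  using F_carrier by auto

lemma F_finite [simp, intro]: "finite F"
  using F_card by (intro card_ge_0_finite) simp

lemma subset_sum_closed [simp, intro]: "T \<subseteq> F \<Longrightarrow> (\<Oplus>v\<in>T. v) \<in> carrier V"
  by (intro finsum_closed) auto

lemma pairing_subset_sum:
  assumes "T \<subseteq> F" "u \<in> carrier V"
  shows "B (\<Oplus>v\<in>T. v) u = (\<Sum>v\<in>T. B v u)"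
  using assms finite_subset[OF assms(1) F_finite] by (intro pairing_finsum_left) auto

text \<open>The basic device: pairing with members of \<open>F\<close> recovers the coefficients of a combination of
  \<open>F\<close>, up to their sum.\<close>

lemma F_combination_pairing:
  assumes "v \<in> F"
  shows "(\<Sum>u\<in>F. \<alpha> u * B u v) = sum \<alpha> F + \<alpha> v"
  using sum_off_diagonal[OF F_finite assms, of \<alpha>] assms
  by (simp add: F_pairing cong: sum.cong)

text \<open>Without one member \<open>v\<close>, the set \<open>F\<close> has as many elements as the dimension, and it is linearly
  independent: pairing a relation with \<open>v\<close> shows that the coefficients sum to zero, and pairing with
  the other members then shows that each coefficient is zero.\<close>

lemma F_span: "span F = carrier V"
proof -
  obtain v where v: "v \<in> F" using F_card by fastforce
  have "lin_indpt (F - {v})"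
  proof (rule finite_lin_indpt2)
    fix a assume "lincomb a (F - {v}) = \<zero>"
    then have lc: "(\<Oplus>u\<in>F - {v}. a u \<odot>\<^bsub>V\<^esub> u) = \<zero>" by (simp add: lincomb_def)
    \<comment> \<open>Extending by zero makes the relation one over all of \<open>F\<close>, where the pairing device applies.\<close>
    define b where "b = a(v := 0)"
    have rel: "(\<Sum>u\<in>F. b u * B u x) = 0" if "x \<in> F" for x
    proof -
      have "(\<Sum>u\<in>F - {v}. a u * B u x) = B (\<Oplus>u\<in>F - {v}. a u \<odot>\<^bsub>V\<^esub> u) x"
        using that by (subst pairing_finsum_left) (auto simp: smult_left intro!: sum.cong)
      also have "\<dots> = 0" using lc that by simp
      also have "(\<Sum>u\<in>F - {v}. a u * B u x) = (\<Sum>u\<in>F. b u * B u x)"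
        by (intro sum.mono_neutral_cong_left) (auto simp: b_def)
      finally show ?thesis .
    qed
    have "sum b F = 0"
      using rel[OF v] F_combination_pairing[OF v, of b] by (simp add: b_def)
    then have b_zero: "b x = 0" if "x \<in> F" for x
      using rel[OF that] F_combination_pairing[OF that, of b] by simp
    have "a u = 0" if "u \<in> F - {v}" for u
      using b_zero[of u] that by (simp add: b_def)
    then show "\<forall>u\<in>F - {v}. a u = \<zero>\<^bsub>class_ring\<^esub>" by simp
  qed auto
  then have "basis (F - {v})"
    using v fin_dim dim F_card by (intro dim_li_is_basis) auto
  then have "span (F - {v}) = carrier V" by (simp add: basis_def)
  moreover have "span (F - {v}) \<subseteq> span F" by (intro span_is_monotone) auto
  moreover have "span F \<subseteq> carrier V" by (intro span_is_subset2 F_carrier)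
  ultimately show ?thesis by auto
qed

lemma additive_eq_on_F:
  assumes "additive h" "additive h'" "\<And>v. v \<in> F \<Longrightarrow> h v = h' v" "u \<in> carrier V"
  shows "h u = h' u"
  using additive_eq_on_span[OF F_carrier F_span assms] .

lemma additive_sum_F: "additive h \<Longrightarrow> sum h F = 0"
  using additive_finsum[of h "\<lambda>v. v" F] by (auto simp: F_sum additive_zero)

text \<open>The functional vanishes on the sum of \<open>F\<close>, so it takes the value 1 on an even number of members
  of \<open>F\<close>. Their sum therefore pairs with each member of \<open>F\<close> to the value of the functional there.\<close>

lemma additive_representable:
  assumes h: "additive h" and u: "u \<in> carrier V"
  shows "B (\<Oplus>v\<in>{v \<in> F. h v = 1}. v) u = h u"
proof (rule additive_eq_on_F[OF additive_pairing_right h _ u])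
  fix x assume x: "x \<in> F"
  have "B (\<Oplus>v\<in>{v \<in> F. h v = 1}. v) x = (\<Sum>v\<in>{v \<in> F. h v = 1}. B v x)"
    using x by (intro pairing_subset_sum) auto
  also have "\<dots> = (\<Sum>v\<in>F. h v * B v x)" by (simp add: sum_bit_support)
  also have "\<dots> = h x"
    using F_combination_pairing[OF x] additive_sum_F[OF h] by simp
  finally show "B (\<Oplus>v\<in>{v \<in> F. h v = 1}. v) x = h x" .
qed auto

lemma qf_diff:
  assumes "q \<in> QV V B" "q' \<in> QV V B"
  shows "qf_diff V B q q' \<in> carrier V \<and> (\<forall>u\<in>carrier V. B (qf_diff V B q q') u = q u + q' u)"
  unfolding qf_diff_def
proof (rule theI')
  let ?v = "\<Oplus>v\<in>{v \<in> F. q v + q' v = 1}. v"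
  have v: "?v \<in> carrier V" "B ?v u = q u + q' u" if "u \<in> carrier V" for u
    using additive_representable[OF additive_QV_diff[OF assms] that] by auto
  show "\<exists>!v. v \<in> carrier V \<and> (\<forall>u\<in>carrier V. B v u = q u + q' u)"
  proof (rule ex1I)
    show "?v \<in> carrier V \<and> (\<forall>u\<in>carrier V. B ?v u = q u + q' u)"
      using v by blast
    show "x = ?v" if "x \<in> carrier V \<and> (\<forall>u\<in>carrier V. B x u = q u + q' u)" for x
      using that v by (intro pairing_inject) auto
  qed
qed

section \<open>The vector space of vectors and quadratic forms\<close>

primrec parity :: "'v + ('v \<Rightarrow> bit) \<Rightarrow> bit" where
  "parity (Inl v) = 0"
| "parity (Inr q) = 1"

primrec value_at :: "'v \<Rightarrow> 'v + ('v \<Rightarrow> bit) \<Rightarrow> bit" where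
  "value_at u (Inl v) = B v u"
| "value_at u (Inr q) = q u"

text \<open>Parity and values together embed the disjoint union into a space of functions. Addition there
  is pointwise, so all vector space axioms can be checked on bits.\<close>

lemma VQV_eqI:
  assumes "x \<in> carrier (VQV V B)" "y \<in> carrier (VQV V B)" "parity x = parity y"
    and "\<And>u. u \<in> carrier V \<Longrightarrow> value_at u x = value_at u y"
  shows "x = y"
  using assms by (cases x; cases y) (auto simp: VQV_def intro: pairing_inject QV_eqI)

lemma VQV_add_closed:
  assumes "x \<in> carrier (VQV V B)" "y \<in> carrier (VQV V B)"
  shows "x \<oplus>\<^bsub>VQV V B\<^esub> y \<in> carrier (VQV V B)"
  using assms qf_diff by (cases x; cases y) (auto simp: VQV_def)

lemma parity_add:
  "parity (x \<oplus>\<^bsub>VQV V B\<^esub> y) = parity x + parity y"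
  by (cases x; cases y) (auto simp: VQV_def)

lemma value_at_add:
  assumes "x \<in> carrier (VQV V B)" "y \<in> carrier (VQV V B)" "u \<in> carrier V"
  shows "value_at u (x \<oplus>\<^bsub>VQV V B\<^esub> y) = value_at u x + value_at u y"
  using assms qf_diff by (cases x; cases y) (auto simp: VQV_def add_left ac_simps)

lemma VQV_zero:
  "\<zero>\<^bsub>VQV V B\<^esub> \<in> carrier (VQV V B)" "parity \<zero>\<^bsub>VQV V B\<^esub> = 0"
  "u \<in> carrier V \<Longrightarrow> value_at u \<zero>\<^bsub>VQV V B\<^esub> = 0"
  by (auto simp: VQV_def)

lemma VQV_smult:
  "a \<odot>\<^bsub>VQV V B\<^esub> x = (if a = 0 then \<zero>\<^bsub>VQV V B\<^esub> else x)"
  by (simp add: VQV_def)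

lemma VQV_module: "Module.module (class_ring :: bit ring) (VQV V B)"
proof -
  note [simp] = VQV_add_closed parity_add value_at_add VQV_zero
  have group: "abelian_group (VQV V B)"
  proof (rule abelian_groupI)
    show "\<exists>y\<in>carrier (VQV V B). y \<oplus>\<^bsub>VQV V B\<^esub> x = \<zero>\<^bsub>VQV V B\<^esub>"
      if "x \<in> carrier (VQV V B)" for x
      using that by (intro bexI[of _ x] VQV_eqI) simp_all
  qed (auto intro!: VQV_eqI simp: ac_simps)
  then interpret abelian_group "VQV V B" .
  have double: "x \<oplus>\<^bsub>VQV V B\<^esub> x = \<zero>\<^bsub>VQV V B\<^esub>" if "x \<in> carrier (VQV V B)" for x
    using that by (intro VQV_eqI) simp_all
  show ?thesis
    by (rule moduleI[OF class_cring.cring_axioms group]) (auto simp: VQV_smult double)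
qed

sublocale VQV: Module.module "class_ring :: bit ring" "VQV V B"
  by (fact VQV_module)

text \<open>Replaces linear combinations of vectors and forms by sums of bits.\<close>

lemma lincomb_coordinates:
  assumes "finite A" "A \<subseteq> carrier (VQV V B)"
  shows "VQV.lincomb \<alpha> A \<in> carrier (VQV V B)
    \<and> parity (VQV.lincomb \<alpha> A) = (\<Sum>x\<in>A. \<alpha> x * parity x)
    \<and> (\<forall>u\<in>carrier V. value_at u (VQV.lincomb \<alpha> A) = (\<Sum>x\<in>A. \<alpha> x * value_at u x))"
  using assms
proof (induction A rule: finite_induct)
  case empty
  then show ?case by (simp add: VQV.lincomb_def VQV_zero)
next
  case (insert x A)
  then have "VQV.lincomb \<alpha> (insert x A) = \<alpha> x \<odot>\<^bsub>VQV V B\<^esub> x \<oplus>\<^bsub>VQV V B\<^esub> VQV.lincomb \<alpha> A"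
    unfolding VQV.lincomb_def by (intro VQV.finsum_insert) auto
  with insert show ?case
    by (auto simp: VQV_smult parity_add value_at_add VQV_zero VQV_add_closed)
qed

end

section \<open>Translates of a form that is constant on a fundamental set\<close>

locale aronhold_base = fundamental_space V B g F
  for V :: "(bit, 'v, 'm) module_scheme" (structure) and B g F +
  fixes p :: "'v \<Rightarrow> bit"
  assumes p: "p \<in> QV V B"
    and p_const: "v \<in> F \<Longrightarrow> p v = of_nat g"
begin

abbreviation translates :: "('v \<Rightarrow> bit) set" where
  "translates \<equiv> qf_add V B p ` F"

lemma inj_on_translate: "inj_on (qf_add V B p) F"
proof (rule inj_onI)
  fix u v assume uv: "u \<in> F" "v \<in> F" "qf_add V B p u = qf_add V B p v"
  have "p u + B u u = p u + B v u"
    using fun_cong[OF uv(3), of u] uv(1) by simp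
  then show "u = v" using uv by (auto simp: F_pairing split: if_splits)
qed

lemma translates_carrier: "Inr ` translates \<subseteq> carrier (VQV V B)"
  using p by (auto simp: VQV_def)

lemma sum_translates:
  fixes h :: "'v + ('v \<Rightarrow> bit) \<Rightarrow> bit"
  shows "(\<Sum>x\<in>Inr ` translates. h x) = (\<Sum>v\<in>F. h (Inr (qf_add V B p v)))"
proof -
  have "inj_on (\<lambda>v. Inr (qf_add V B p v) :: 'v + ('v \<Rightarrow> bit)) F"
    using inj_on_translate by (auto simp: inj_on_def)
  then show ?thesis by (simp add: image_image sum.reindex)
qed

lemma lincomb_translates:
  shows "VQV.lincomb \<alpha> (Inr ` translates) \<in> carrier (VQV V B)"
    and "parity (VQV.lincomb \<alpha> (Inr ` translates)) = (\<Sum>v\<in>F. \<alpha> (Inr (qf_add V B p v)))"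
    and "u \<in> carrier V \<Longrightarrow> value_at u (VQV.lincomb \<alpha> (Inr ` translates))
      = (\<Sum>v\<in>F. \<alpha> (Inr (qf_add V B p v))) * p u + (\<Sum>v\<in>F. \<alpha> (Inr (qf_add V B p v)) * B v u)"
  using lincomb_coordinates[of "Inr ` translates" \<alpha>] translates_carrier
  by (simp_all add: sum_translates distrib_left sum.distrib sum_distrib_right)

lemma translates_lin_indpt: "VQV.lin_indpt (Inr ` translates)"
proof (rule VQV.finite_lin_indpt2[OF _ translates_carrier])
  fix \<alpha> assume lc: "VQV.lincomb \<alpha> (Inr ` translates) = \<zero>\<^bsub>VQV V B\<^esub>"
  let ?\<alpha> = "\<lambda>v. \<alpha> (Inr (qf_add V B p v))"
  have "sum ?\<alpha> F = 0"
    using lincomb_translates(2)[of \<alpha>] by (simp add: lc VQV_zero)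
  then have "?\<alpha> v = 0" if "v \<in> F" for v
    using lincomb_translates(3)[of v \<alpha>] F_combination_pairing[OF that, of ?\<alpha>] that
    by (simp add: lc VQV_zero)
  then show "\<forall>x\<in>Inr ` translates. \<alpha> x = \<zero>\<^bsub>class_ring\<^esub>" by auto
qed simp

text \<open>Reads off the coordinates of \<open>q\<close> with respect to the translates \<open>p + v\<close>. Since \<open>p + q\<close> is
  linear and the members of \<open>F\<close> sum to zero, the coefficients \<open>p v + q v + 1\<close> sum to
  \<open>card F\<close>, which is odd; the off-diagonal pairing on \<open>F\<close> then turns them back into the values \<open>p v + q v\<close>.\<close>

lemma agreement_coefficients:
  assumes q: "q \<in> QV V B"
  shows "(\<Sum>v\<in>F. p v + q v + 1) = 1"
    and "u \<in> carrier V \<Longrightarrow> (\<Sum>v\<in>F. (p v + q v + 1) * B v u) = p u + q u"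
proof -
  have add: "additive (\<lambda>u. p u + q u)" by (rule additive_QV_diff[OF p q])
  have "(\<Sum>v\<in>F. p v + q v + 1) = sum (\<lambda>v. p v + q v) F + of_nat (card F)"
    by (simp only: sum.distrib sum_constant) simp
  also have "\<dots> = 1"
    using additive_sum_F[OF add] by (simp add: F_card)
  finally show s: "(\<Sum>v\<in>F. p v + q v + 1) = 1" .
  assume u: "u \<in> carrier V"
  show "(\<Sum>v\<in>F. (p v + q v + 1) * B v u) = p u + q u"
  proof (rule additive_eq_on_F[OF _ add _ u])
    show "additive (\<lambda>u. \<Sum>v\<in>F. (p v + q v + 1) * B v u)"
      by (simp add: additive_def add_right distrib_left sum.distrib)
    show "(\<Sum>v\<in>F. (p v + q v + 1) * B v x) = p x + q x" if "x \<in> F" for x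
      using F_combination_pairing[OF that, of "\<lambda>v. p v + q v + 1"] s by (simp add: ac_simps)
  qed
qed

lemma lincomb_translates_eq_iff:
  assumes q: "q \<in> QV V B"
  shows "VQV.lincomb \<alpha> (Inr ` translates) = Inr q \<longleftrightarrow>
    (\<forall>v\<in>F. \<alpha> (Inr (qf_add V B p v)) = p v + q v + 1)" (is "?l \<longleftrightarrow> ?r")
proof
  let ?\<alpha> = "\<lambda>v. \<alpha> (Inr (qf_add V B p v))"
  assume l: ?l
  have s: "sum ?\<alpha> F = 1" using lincomb_translates(2)[of \<alpha>] by (simp add: l)
  show ?r
  proof
    fix v assume v: "v \<in> F"
    have "q v = p v + (1 + ?\<alpha> v)"
      using lincomb_translates(3)[of v \<alpha>] F_combination_pairing[OF v, of ?\<alpha>] v s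
      by (simp add: l)
    then show "?\<alpha> v = p v + q v + 1"
      by (cases "p v"; cases "?\<alpha> v") simp_all
  qed
next
  let ?\<alpha> = "\<lambda>v. \<alpha> (Inr (qf_add V B p v))"
  assume r: ?r
  have s: "sum ?\<alpha> F = 1"
    using r agreement_coefficients(1)[OF q] by simp
  have comb: "(\<Sum>v\<in>F. ?\<alpha> v * B v u) = p u + q u" if "u \<in> carrier V" for u
    using r agreement_coefficients(2)[OF q that] by simp
  show ?l
  proof (rule VQV_eqI[OF lincomb_translates(1)])
    show "Inr q \<in> carrier (VQV V B)" using q by (auto simp: VQV_def)
    show "parity (VQV.lincomb \<alpha> (Inr ` translates)) = parity (Inr q)"
      by (simp add: lincomb_translates(2) s)
    show "value_at u (VQV.lincomb \<alpha> (Inr ` translates)) = value_at u (Inr q)"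
      if "u \<in> carrier V" for u
      using that by (simp add: lincomb_translates(3) s comb)
  qed
qed

text \<open>Coefficients are extensional functions, so the values on the translates determine them.\<close>

lemma coeffs_wrt_translates:
  assumes q: "q \<in> QV V B" and v: "v \<in> F"
  shows "coeffs_wrt V B translates q (Inr (qf_add V B p v)) = p v + q v + 1"
proof -
  let ?P = "\<lambda>\<alpha>. \<alpha> \<in> Inr ` translates \<rightarrow>\<^sub>E UNIV \<and>
    VQV.lincomb \<alpha> (Inr ` translates) = Inr q"
  let ?v = "\<lambda>x. inv_into F (qf_add V B p) (projr x)"
  let ?\<alpha> = "\<lambda>x\<in>Inr ` translates. p (?v x) + q (?v x) + 1"
  have "?P ?\<alpha>"
    using inj_on_translate by (auto simp: lincomb_translates_eq_iff[OF q])
  moreover have "\<alpha> = \<beta>" if "?P \<alpha>" "?P \<beta>" for \<alpha> \<beta>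
  proof (rule PiE_ext)
    show "\<alpha> \<in> Inr ` translates \<rightarrow>\<^sub>E UNIV" "\<beta> \<in> Inr ` translates \<rightarrow>\<^sub>E UNIV"
      using that by auto
    show "\<alpha> x = \<beta> x" if "x \<in> Inr ` translates" for x
      using that \<open>?P \<alpha>\<close> \<open>?P \<beta>\<close> by (auto simp: lincomb_translates_eq_iff[OF q])
  qed
  ultimately have "\<exists>!\<alpha>. ?P \<alpha>" by (intro ex1I[of ?P])
  then have "?P (coeffs_wrt V B translates q)"
    unfolding coeffs_wrt_def by (rule theI'[of ?P])
  with v show ?thesis by (simp add: lincomb_translates_eq_iff[OF q])
qed

lemma qf_length_translates:
  assumes q: "q \<in> QV V B"
  shows "qf_length V B translates q = card {v \<in> F. p v = q v}"
proof -
  have "coeffs_wrt V B translates q (Inr (qf_add V B p v)) \<noteq> 0 \<longleftrightarrow> p v = q v" if "v \<in> F" for v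
    unfolding coeffs_wrt_translates[OF q that] by (cases "p v"; cases "q v") simp_all
  then have "{s \<in> translates. coeffs_wrt V B translates q (Inr s) \<noteq> 0}
      = qf_add V B p ` {v \<in> F. p v = q v}"
    by auto
  then show ?thesis
    unfolding qf_length_def
    by (simp add: card_image inj_on_subset[OF inj_on_translate])
qed

lemma qf_add_agreement_sum:
  assumes q: "q \<in> QV V B"
  shows "q = qf_add V B p (\<Oplus>v\<in>{v \<in> F. p v = q v}. v)" (is "q = qf_add V B p ?s")
proof (rule QV_eqI[OF q])
  show "qf_add V B p ?s \<in> QV V B" by (intro qf_add_closed p) auto
  fix u assume u: "u \<in> carrier V"
  have "{v \<in> F. p v = q v} = {v \<in> F. p v + q v + 1 = 1}"
    by (auto simp: bit_add_eq_iff)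
  then have "B ?s u = (\<Sum>v\<in>F. (p v + q v + 1) * B v u)"
    using u by (subst pairing_subset_sum) (auto simp: sum_bit_support)
  then show "q u = qf_add V B p ?s u"
    using u agreement_coefficients(2)[OF q u] by simp
qed

text \<open>Each member of \<open>T\<close> contributes \<open>g\<close>, and each pair of members contributes 1.\<close>

lemma base_at_subset_sum:
  assumes "T \<subseteq> F"
  shows "p (\<Oplus>v\<in>T. v) = of_nat (card T) * of_nat g + of_nat (card T choose 2)"
proof -
  have "p (\<Oplus>v\<in>T. v) = (\<Sum>v\<in>T. p v) + of_nat (card T choose 2)"
    using assms finite_subset[OF assms F_finite]
    by (intro QV_finsum_pairing_one p) (auto simp: F_pairing subset_iff)
  also have "(\<Sum>v\<in>T. p v) = (\<Sum>v\<in>T. of_nat g)"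
    using assms by (intro sum.cong) (auto simp: p_const)
  finally show ?thesis by simp
qed

lemma arf_depends_on_length:
  assumes q: "q \<in> QV V B" "q' \<in> QV V B"
    and len: "[qf_length V B translates q = qf_length V B translates q'] (mod 4)"
  shows "arf V B g q = arf V B g q'"
proof -
  let ?s = "\<lambda>q. \<Oplus>v\<in>{v \<in> F. p v = q v}. v"
  have "[card {v \<in> F. p v = q v} = card {v \<in> F. p v = q' v}] (mod 4)"
    using len q by (simp add: qf_length_translates)
  then have "p (?s q) = p (?s q')"
    by (simp add: base_at_subset_sum of_nat_bit_cong_mod_4[of "card {v \<in> F. p v = q v}"]
        of_nat_choose_two_bit_cong[of "card {v \<in> F. p v = q v}"])
  then have "arf V B g (qf_add V B p (?s q)) = arf V B g (qf_add V B p (?s q'))"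
    by (intro arf_qf_add_cong p) auto
  then show ?thesis
    using qf_add_agreement_sum[OF q(1)] qf_add_agreement_sum[OF q(2)] by simp
qed

theorem aronhold_basis_translates: "aronhold_basis V B g translates"
  unfolding aronhold_basis_def
proof (intro conjI ballI impI)
  show "translates \<subseteq> QV V B" using p by auto
  show "card translates = 2 * g + 1" by (simp add: card_image[OF inj_on_translate] F_card)
qed (fact translates_lin_indpt, rule arf_depends_on_length)

end

section \<open>Making a form constant on a fundamental set\<close>

context fundamental_space
begin

text \<open>The sum of \<open>F\<close> is zero, so the quadratic relation reads \<open>0 = (2 g + 1) c + (2 g + 1 choose 2)\<close>,
  where the binomial coefficient is \<open>g (2 g + 1)\<close>.\<close>

lemma constant_on_F:
  assumes q: "q \<in> QV V B" and const: "\<And>v. v \<in> F \<Longrightarrow> q v = c"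
  shows "c = of_nat g"
proof -
  have "0 = q (\<Oplus>v\<in>F. v)" using QV_zero[OF q] by (simp add: F_sum)
  also have "\<dots> = (\<Sum>v\<in>F. q v) + of_nat (card F choose 2)"
    by (intro QV_finsum_pairing_one q) (auto simp: F_pairing)
  also have "(\<Sum>v\<in>F. q v) = c" using const by (simp add: F_card)
  also have "card F choose 2 = g + 2 * g * g"
    by (simp add: F_card choose_two algebra_simps)
  finally have "c + of_nat g = 0" by simp
  then show ?thesis by (simp only: bit_add_eq_zero_iff)
qed

text \<open>The indicator of the level set \<open>T\<close> is \<open>q u + \<mu> + 1\<close>. Pairing the sum of \<open>T\<close> with \<open>v\<close> gives the
  cardinality of \<open>T\<close> plus this indicator at \<open>v\<close>, and the term \<open>q v\<close> cancels: the right side is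
  independent of \<open>v\<close>.\<close>

lemma level_set_translate_on_F:
  fixes \<mu> :: bit
  assumes q: "q \<in> QV V B" and v: "v \<in> F"
  defines "T \<equiv> {v \<in> F. q v = \<mu>}"
  shows "qf_add V B q (\<Oplus>v\<in>T. v) v = of_nat (card T) + \<mu> + 1"
proof -
  have T: "T \<subseteq> F" "finite T" unfolding T_def by auto
  have "B (\<Oplus>v\<in>T. v) v = (\<Sum>u\<in>F. (q u + \<mu> + 1) * B u v)"
    using v T by (simp add: pairing_subset_sum sum_bit_support T_def bit_add_eq_iff)
  also have "\<dots> = sum (\<lambda>u. q u + \<mu> + 1) F + (q v + \<mu> + 1)"
    by (rule F_combination_pairing[OF v])
  also have "sum (\<lambda>u. q u + \<mu> + 1) F = sum (\<lambda>u. (q u + \<mu> + 1) * 1) F" by simp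
  also have "\<dots> = of_nat (card T)"
    by (simp only: sum_bit_support F_finite) (simp add: T_def bit_add_eq_iff)
  finally show ?thesis using v by (simp add: ac_simps)
qed

end

theorem proposition2p4:
  fixes V :: "(bit, 'v, 'm) module_scheme"
    and B :: "'v \<Rightarrow> 'v \<Rightarrow> bit"
    and g :: nat
    and F :: "'v set"
    and q :: "'v \<Rightarrow> bit"
    and \<mu> :: bit
    and w :: 'v
  assumes "g \<ge> 1"
    and "symplectic_space V B g"
    and "fundamental_set V B g F"
    and "q \<in> QV V B"
    and "w = (\<Oplus>\<^bsub>V\<^esub>v\<in>{v \<in> F. q v = \<mu>}. v)"
  shows "aronhold_basis V B g ((\<lambda>v. qf_add V B (qf_add V B q w) v) ` F)"
proof -
  interpret fundamental_space V B g F
    using assms(2,3) by (simp add: fundamental_space_def fundamental_space_axioms_def)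
  have closed: "qf_add V B q w \<in> QV V B"
    using assms(4,5) by auto
  have const: "qf_add V B q w v = of_nat (card {v \<in> F. q v = \<mu>}) + \<mu> + 1" if "v \<in> F" for v
    unfolding assms(5) by (rule level_set_translate_on_F[OF assms(4) that])
  interpret aronhold_base V B g F "qf_add V B q w"
  proof
    show "qf_add V B q w v = of_nat g" if "v \<in> F" for v
      using constant_on_F[OF closed const] const[OF that] by simp
  qed (fact closed)
  show ?thesis by (rule aronhold_basis_translates)
qed

end
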